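(* Let $N\geq 1$ be a positive integer, let $\zeta_N = e^{2\pi i/N}$, and let $X$ be an indeterminate. Let \[ C_N=\left\{\begin{pmatrix} a & b \\ 0 & d\end{pmatrix} : a,b,d\in\mathbb{Z},\ ad=N,\ a\geq 1,\ 0\leq b\leq d-1,\ \gcd(a,b,d)=1\right\}, \] and let $\psi(N)=\#C_N = N\prod_{p\mid N}\left(1+\frac{1}{p}\right)$ (product over primes $p$ dividing $N$). Then, as formal power series in $X$ with coefficients in $\mathbb{Q}(\zeta_N)$, \[ \prod_{\begin{pmatrix} a & b \\ 0 & d\end{pmatrix}\in C_N}\left(1+\sum_{n=1}^{\infty}\zeta_N^{abn}\,p(n)\,X^{a^2 n}\right) = \left(1+\sum_{n=1}^{\infty}p(n)\,X^{Nn}\right)^{\psi(N)}. \]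
   Context: For a positive integer $n$, $p(n)$ denotes the number of partitions of $n$, i.e. the number of ways of writing $n$ as a sum of positive integers, where sums differing only in the order of terms are identified. *)

theory Defs
  imports
    "HOL-Analysis.Analysis"
    "HOL-Library.Multiset"
    "HOL-Computational_Algebra.Formal_Power_Series"
    "HOL-Computational_Algebra.Primes"
begin

(* A partition is the multiset of its (positive) parts. *)
definition partition_number :: "nat \<Rightarrow> nat" where
  "partition_number n = card {P :: nat multiset. (\<forall>k \<in># P. 0 < k) \<and> sum_mset P = n}"

definition zeta :: "nat \<Rightarrow> complex" where
  "zeta N = exp (2 * of_real pi * \<i> / of_nat N)"

definition cyclic_matrices :: "nat \<Rightarrow> (int ^ 2 ^ 2) set" where
  "cyclic_matrices N =
     {M. \<exists>a b d. M = vector [vector [a, b], vector [0, d]] \<and>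
        a * d = int N \<and> 1 \<le> a \<and> 0 \<le> b \<and> b \<le> d - 1 \<and> gcd a (gcd b d) = 1}"

definition psi :: "nat \<Rightarrow> nat" where
  "psi N = card (cyclic_matrices N)"

end

theory Submission
  imports Defs "HOL-Computational_Algebra.Squarefree" "HOL-Number_Theory.Cong"
begin

text \<open>
  Call a pair \<open>(a, b)\<close> with \<open>ad = N\<close> and \<open>0 \<le> b < d\<close> a Hecke pair, without requiring
  \<open>gcd(a, b, d) = 1\<close>. Since the partition series is the inverse of \<open>\<Prod>(1 - X^m)\<close>, the product
  over all Hecke pairs amounts to the product of \<open>1 - \<zeta>_d^(bm) X^(a^2 m)\<close>; over \<open>b < d\<close> these
  factors give \<open>(1 - X^(a^2 m d/g))^g\<close> with \<open>g = gcd(d, m)\<close>. The substitution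
  \<open>s = N/g, M = am/g\<close>, with inverse \<open>a = gcd(s, M)\<close>, turns this into
  \<open>(1 - X^(NM))^(N/s)\<close> over all \<open>s | N\<close> and \<open>M \<ge> 1\<close>, so that the identity holds for all
  Hecke pairs with the exponent \<open>\<sigma>(N)\<close>. Every Hecke pair for \<open>N\<close> is \<open>e\<close> times a primitive one
  for \<open>N/e^2\<close>, which gives the primitive identity by induction and cancellation. Counting
  Hecke pairs in the same way, \<open>\<Sum>\<psi>(N/e^2) = \<sigma>(N)\<close>; the sum of \<open>N/s\<close> over squarefree \<open>s | N\<close>
  satisfies the same recursion, because every \<open>t | N\<close> is uniquely \<open>e^2 s\<close> with \<open>s\<close> squarefree.
\<close>

subsection \<open>Partitions with bounded parts\<close>

definition bounded_partitions :: "nat \<Rightarrow> nat \<Rightarrow> nat multiset set" where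
  "bounded_partitions K n = {P. set_mset P \<subseteq> {1..K} \<and> sum_mset P = n}"

lemma bounded_partitions_0: "bounded_partitions 0 n = (if n = 0 then {{#}} else {})"
  by (auto simp: bounded_partitions_def)

text \<open>Split by whether the part \<open>Suc K\<close> occurs. If it does, one copy is removed;
  the remainder may still contain \<open>Suc K\<close>, so the bound on the parts stays while the
  total drops.\<close>

lemma bounded_partitions_Suc:
  "bounded_partitions (Suc K) n = bounded_partitions K n \<union>
     (if Suc K \<le> n then add_mset (Suc K) ` bounded_partitions (Suc K) (n - Suc K) else {})"
  (is "?L = ?A \<union> ?B")
proof
  show "?L \<subseteq> ?A \<union> ?B"
  proof
    fix P assume P: "P \<in> ?L"
    show "P \<in> ?A \<union> ?B"
    proof (cases "Suc K \<in># P")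
      case True
      then obtain Q where Q: "P = add_mset (Suc K) Q" by (metis insert_DiffM)
      with P have "Q \<in> bounded_partitions (Suc K) (n - Suc K)" "Suc K \<le> n"
        by (auto simp: bounded_partitions_def)
      with Q show ?thesis by auto
    next
      case False
      have "k \<in> {1..K}" if "k \<in># P" for k
      proof -
        have "k \<in> {1..Suc K}" using P that by (auto simp: bounded_partitions_def)
        moreover have "k \<noteq> Suc K" using False that by blast
        ultimately show ?thesis by auto
      qed
      with P show ?thesis by (auto simp: bounded_partitions_def)
    qed
  qed
  show "?A \<union> ?B \<subseteq> ?L"
    by (auto simp: bounded_partitions_def subset_iff split: if_splits) 
qed

lemma finite_bounded_partitions: "finite (bounded_partitions K n)"
proof (induction K arbitrary: n)
  case 0
  show ?case by (simp add: bounded_partitions_0)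
next
  case (Suc K)
  show ?case
  \<comment> \<open>An inner induction on \<open>n\<close> is needed because the second branch of
    the recursion keeps the bound \<open>Suc K\<close>.\<close>
  proof (induction n rule: less_induct)
    case (less n)
    show ?case
      using Suc.IH less.IH[of "n - Suc K"] by (subst bounded_partitions_Suc) auto
  qed
qed

lemma card_bounded_partitions_Suc:
  "card (bounded_partitions (Suc K) n) = card (bounded_partitions K n) +
     (if Suc K \<le> n then card (bounded_partitions (Suc K) (n - Suc K)) else 0)"
proof -
  have "bounded_partitions K n \<inter> add_mset (Suc K) ` bounded_partitions (Suc K) (n - Suc K) = {}"
  proof -
    have "Suc K \<notin># P" if "P \<in> bounded_partitions K n" for P
      using that unfolding bounded_partitions_def by (metis (mono_tags, lifting) atLeastAtMost_iff
          mem_Collect_eq not_less_eq_eq order_refl subset_iff)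
    moreover have "Suc K \<in># P" if "P \<in> add_mset (Suc K) ` X" for P X
      using that by auto
    ultimately show ?thesis by blast
  qed
  moreover have "card (add_mset (Suc K) ` bounded_partitions (Suc K) (n - Suc K))
      = card (bounded_partitions (Suc K) (n - Suc K))"
    by (intro card_image) (auto simp: inj_on_def)
  ultimately show ?thesis
    unfolding bounded_partitions_Suc[of K n]
    by (auto simp: card_Un_disjoint finite_bounded_partitions)
qed

lemma partition_number_eq_bounded:
  assumes "n \<le> K"
  shows "partition_number n = card (bounded_partitions K n)"
proof -
  have "k \<le> n" if "k \<in># P" "sum_mset P = n" for k and P :: "nat multiset"
    using that by (metis insert_DiffM le_add1 sum_mset.add_mset)
  then have "(\<forall>k\<in>#P. 0 < k) \<longleftrightarrow> set_mset P \<subseteq> {1..K}" if "sum_mset P = n" for P :: "nat multiset"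
    using assms that by (fastforce simp: subset_iff Suc_le_eq)
  then have "{P. (\<forall>k\<in>#P. 0 < k) \<and> sum_mset P = n} = bounded_partitions K n"
    unfolding bounded_partitions_def by blast
  then show ?thesis by (simp add: partition_number_def)
qed

lemma partition_number_0: "partition_number 0 = 1"
  using partition_number_eq_bounded[of 0 0] by (simp add: bounded_partitions_0)

section \<open>The partition series and the truncated Euler product\<close>

definition partition_fps :: "complex fps" where
  "partition_fps = Abs_fps (\<lambda>n. of_nat (partition_number n))"

definition euler_prod :: "nat \<Rightarrow> complex fps" where
  "euler_prod K = (\<Prod>m = 1..K. 1 - fps_X ^ m)"

text \<open>The counting recursion reads G(K+1) = G(K) + X^(K+1) G(K+1), so multiplying G(K+1) by
  the new factor 1 - X^(K+1) gives back G(K).\<close>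

lemma bounded_partitions_euler_prod:
  "Abs_fps (\<lambda>n. of_nat (card (bounded_partitions K n))) * euler_prod K = 1"
proof (induction K)
  case 0
  show ?case by (rule fps_ext) (simp add: euler_prod_def bounded_partitions_0)
next
  case (Suc K)
  let ?G = "\<lambda>K. Abs_fps (\<lambda>n. of_nat (card (bounded_partitions K n))) :: complex fps"
  have "?G (Suc K) = ?G K + fps_X ^ Suc K * ?G (Suc K)"
  proof (rule fps_ext)
    fix n
    show "fps_nth (?G (Suc K)) n = fps_nth (?G K + fps_X ^ Suc K * ?G (Suc K)) n"
      using card_bounded_partitions_Suc[of K n]
      by (simp add: fps_X_power_mult_nth del: power_Suc)
  qed
  then have "?G (Suc K) * (1 - fps_X ^ Suc K) = ?G K" by (simp add: algebra_simps)
  moreover have "euler_prod (Suc K) = (1 - fps_X ^ Suc K) * euler_prod K"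
    by (simp add: euler_prod_def mult.commute)
  ultimately show ?case using Suc.IH by (metis mult.assoc)
qed

subsection \<open>Congruence of power series modulo a power of the variable\<close>

text \<open>Working modulo X^L lets the finite \<open>euler_prod L\<close> replace the infinite
  Euler product; equality is recovered at the end from all \<open>L\<close>.\<close>

definition fps_eq_upto :: "nat \<Rightarrow> 'a fps \<Rightarrow> 'a fps \<Rightarrow> bool" where
  "fps_eq_upto L f g \<longleftrightarrow> (\<forall>i<L. fps_nth f i = fps_nth g i)"

lemma fps_eq_upto_refl [simp]: "fps_eq_upto L f f"
  by (simp add: fps_eq_upto_def)

lemma fps_eq_upto_sym: "fps_eq_upto L f g \<Longrightarrow> fps_eq_upto L g f"
  by (simp add: fps_eq_upto_def)

lemma fps_eq_upto_trans [trans]: "fps_eq_upto L f g \<Longrightarrow> fps_eq_upto L g h \<Longrightarrow> fps_eq_upto L f h"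
  by (simp add: fps_eq_upto_def)

lemma fps_eq_upto_mult:
  "fps_eq_upto L f g \<Longrightarrow> fps_eq_upto L f' g' \<Longrightarrow> fps_eq_upto L (f * f') (g * g')"
  for f g :: "'a :: comm_semiring_1 fps"
  by (auto simp: fps_eq_upto_def fps_mult_nth intro!: sum.cong)

lemma fps_eq_upto_prod:
  "(\<And>x. x \<in> A \<Longrightarrow> fps_eq_upto L (f x) (g x)) \<Longrightarrow> fps_eq_upto L (prod f A) (prod g A)"
  for f g :: "'b \<Rightarrow> 'a :: comm_semiring_1 fps"
  by (induction A rule: infinite_finite_induct) (auto intro: fps_eq_upto_mult)

lemma fps_eq_upto_power:
  "fps_eq_upto L f g \<Longrightarrow> fps_eq_upto L (f ^ n) (g ^ n)"
  for f g :: "'a :: comm_semiring_1 fps"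
  by (induction n) (auto intro: fps_eq_upto_mult)

text \<open>Coefficient i of a composition uses only the coefficients of the outer series up to
  index i.\<close>

lemma fps_eq_upto_compose:
  "fps_eq_upto L f g \<Longrightarrow> fps_eq_upto L (f oo h) (g oo h)"
  for f g :: "'a :: comm_semiring_1 fps"
  by (auto simp: fps_eq_upto_def fps_compose_nth intro!: sum.cong)

lemma fps_eq_upto_imp_eq: "(\<And>L. fps_eq_upto L f g) \<Longrightarrow> f = g"
  by (auto simp: fps_eq_upto_def fps_eq_iff)

text \<open>A partition of n \<le> L has no part above L, so up to and including X^L the partition
  series agrees with the bounded series, whose product with \<open>euler_prod L\<close> is exactly
  1.\<close>

lemma partition_euler_prod: "fps_eq_upto (Suc L) (partition_fps * euler_prod L) 1"
proof -
  have "fps_eq_upto (Suc L) partition_fps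
          (Abs_fps (\<lambda>n. of_nat (card (bounded_partitions L n))))"
    by (simp add: fps_eq_upto_def partition_fps_def partition_number_eq_bounded)
  from fps_eq_upto_mult[OF this fps_eq_upto_refl[of _ "euler_prod L"]] show ?thesis
    by (simp add: bounded_partitions_euler_prod)
qed

text \<open>Since \<open>g\<close> has no constant term, g^i starts at X^i or later; coefficient j
  of the partial sums is therefore constant once n > j, which is convergence of power
  series.\<close>

lemma sums_fps_compose_Suc:
  fixes f g :: "'a :: comm_ring_1 fps"
  assumes "fps_nth g 0 = 0"
  shows "(\<lambda>n. fps_const (fps_nth f (Suc n)) * g ^ Suc n) sums ((f oo g) - fps_const (fps_nth f 0))"
  unfolding sums_def
proof (rule tendsto_fpsI)
  fix j
  show "\<forall>\<^sub>F n in sequentially. fps_nth (\<Sum>i<n. fps_const (fps_nth f (Suc i)) * g ^ Suc i) j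
          = fps_nth ((f oo g) - fps_const (fps_nth f 0)) j"
    using eventually_gt_at_top[of j]
  proof eventually_elim
    case (elim n)
    have "(\<Sum>i<n. fps_nth f (Suc i) * fps_nth (g ^ Suc i) j) = (\<Sum>i<Suc n. fps_nth f i * fps_nth (g ^ i) j) - fps_nth f 0 * fps_nth 1 j"
      by (subst sum.lessThan_Suc_shift) simp
    also have "(\<Sum>i<Suc n. fps_nth f i * fps_nth (g ^ i) j) = (\<Sum>i=0..j. fps_nth f i * fps_nth (g ^ i) j)"
      using elim assms
      by (intro sum.mono_neutral_right) (auto simp: startsby_zero_power_prefix)
    finally show ?case by (simp add: fps_sum_nth fps_compose_nth del: power_Suc)
  qed
qed

text \<open>This translates the infinite sums of the theorem into compositions; the leading 1 is the
  term p(0).\<close>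

lemma partition_fps_compose_eq_suminf:
  assumes "k > 0"
  shows "1 + (\<Sum>n. fps_const (c ^ Suc n * of_nat (partition_number (Suc n))) * fps_X ^ (k * Suc n))
       = partition_fps oo (fps_const c * fps_X ^ k)"
proof -
  let ?g = "fps_const c * fps_X ^ k :: complex fps"
  have "fps_nth ?g 0 = 0" using assms by simp
  from sums_unique[OF sums_fps_compose_Suc[OF this, of partition_fps]]
  have *: "(\<Sum>n. fps_const (fps_nth partition_fps (Suc n)) * ?g ^ Suc n) = (partition_fps oo ?g) - 1"
    by (simp add: partition_fps_def partition_number_0)
  have "fps_const (c ^ Suc n * of_nat (partition_number (Suc n))) * fps_X ^ (k * Suc n)
      = fps_const (fps_nth partition_fps (Suc n)) * ?g ^ Suc n" for n
  proof -
    have "?g ^ Suc n = fps_const (c ^ Suc n) * fps_X ^ (k * Suc n)"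
      by (simp only: power_mult_distrib fps_const_power power_mult)
    then show ?thesis
      by (simp only: partition_fps_def fps_nth_Abs_fps mult_ac flip: fps_const_mult)
  qed
  then show ?thesis by (simp only: *) simp
qed

subsection \<open>Roots of unity\<close>

text \<open>Both sides are polynomials in \<open>y\<close> of degree at most \<open>h\<close>, and
  they agree at 0 and at the \<open>h\<close> distinct powers of \<open>w\<close>, hence at h + 1
  points. A general integral domain is taken because the lemma is applied with power series for
  \<open>w\<close> and \<open>y\<close>.\<close>

lemma prod_one_minus_root_of_unity:
  fixes w y :: "'a :: idom"
  assumes "w ^ h = 1" and inj: "inj_on (\<lambda>j. w ^ j) {..<h}" and "h > 0"
  shows "(\<Prod>b<h. 1 - w ^ b * y) = 1 - y ^ h"
proof -
  define R where "R = (\<Prod>b<h. [:1, - (w ^ b):]) - (1 - monom 1 h)"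
  have eval: "poly R x = (\<Prod>b<h. 1 - w ^ b * x) - (1 - x ^ h)" for x
    by (simp add: R_def poly_prod poly_monom mult.commute)
  have "R = 0"
  proof (rule ccontr)
    assume "R \<noteq> 0"
    have root: "poly R (w ^ j) = 0" if "j < h" for j
    proof -
      \<comment> \<open>\<open>b\<close> is the exponent inverse to \<open>j\<close>, so the factor
        with index \<open>b\<close> vanishes at w^j; the \<open>mod\<close> brings the case j = 0
        back into range.\<close>
      define b where "b = (h - j) mod h"
      have "w ^ b * w ^ j = 1"
      proof (cases "j = 0")
        case False
        then have "b + j = h" using that by (simp add: b_def)
        then show ?thesis using assms(1) by (simp flip: power_add)
      qed (simp add: b_def)
      moreover have "b < h" using \<open>h > 0\<close> by (simp add: b_def)
      ultimately have "(\<Prod>b<h. 1 - w ^ b * w ^ j) = 0" by (intro prod_zero) auto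
      moreover have "(w ^ j) ^ h = 1"
        using assms(1) by (metis mult.commute power_mult power_one)
      ultimately show ?thesis by (simp add: eval)
    qed
    have root0: "poly R 0 = 0" using \<open>h > 0\<close> by (simp add: eval)
    \<comment> \<open>As \<open>w\<close> is nonzero, the root 0 is distinct from the powers of
      \<open>w\<close>, which brings the number of roots above the degree bound.\<close>
    have "w \<noteq> 0" using assms(1,3) by (auto simp: power_0_left)
    then have "card (insert 0 ((\<lambda>j. w ^ j) ` {..<h})) = Suc h"
      using inj by (subst card_insert_disjoint) (auto simp: card_image dest: sym)
    moreover have "card (insert 0 ((\<lambda>j. w ^ j) ` {..<h})) \<le> card {x. poly R x = 0}"
      using root root0 poly_roots_finite[OF \<open>R \<noteq> 0\<close>] by (intro card_mono) auto
    moreover have "card {x. poly R x = 0} \<le> degree R"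
      by (rule card_poly_roots_bound[OF \<open>R \<noteq> 0\<close>])
    moreover have "degree R \<le> h"
    proof -
      have "degree (\<Prod>b<h. [:1, - (w ^ b):]) \<le> (\<Sum>b<h. degree [:1, - (w ^ b):])"
        using degree_prod_sum_le[of "{..<h}" "\<lambda>b. [:1, - (w ^ b):]"] by (simp add: o_def)
      also have "\<dots> \<le> (\<Sum>b<h. 1)" by (intro sum_mono) simp
      finally show ?thesis unfolding R_def
        by (intro degree_diff_le) (auto simp: degree_monom_le)
    qed
    ultimately show False by simp
  qed
  with eval[of y] show ?thesis by simp
qed

lemma prod_lessThan_periodic:
  fixes f :: "nat \<Rightarrow> 'a :: comm_monoid_mult"
  assumes "\<And>b. f (b + h) = f b"
  shows "prod f {..<g * h} = prod f {..<h} ^ g"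
proof -
  have per: "f (b + m * h) = f b" for b m
  proof (induction m)
    case (Suc m)
    show ?case using assms[of "b + m * h"] Suc by (simp add: algebra_simps)
  qed simp
  have "prod f {m * h..<m * h + h} = prod f {..<h}" for m
    using prod.shift_bounds_nat_ivl[of f 0 "m * h" h] per by (simp add: lessThan_atLeast0 add.commute)
  then show ?thesis by (simp flip: prod.nat_group)
qed

lemma zeta_power: "zeta N ^ j = exp (2 * of_real pi * \<i> * of_nat j / of_nat N)"
  by (simp add: zeta_def mult_ac flip: exp_of_nat_mult)

lemma zeta_power_cancel:
  assumes "k > 0"
  shows "zeta (k * n) ^ (k * j) = zeta n ^ j"
  using assms by (simp add: zeta_power mult_ac)

lemma zeta_power_eq_iff: "N > 0 \<Longrightarrow> zeta N ^ i = zeta N ^ j \<longleftrightarrow> i mod N = j mod N"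
  using complex_root_unity_eq[of N i j] by (simp add: zeta_power)

lemma zeta_power_self [simp]: "N > 0 \<Longrightarrow> zeta N ^ N = 1"
  using zeta_power_eq_iff[of N N 0] by simp

text \<open>With g = gcd(d, m), the number zeta_d^m is a primitive root of unity of order d/g, so
  its powers with exponent below d run g times through all roots of that order.\<close>

lemma prod_one_minus_zeta_power:
  fixes y :: "complex fps"
  assumes "d > 0"
  shows "(\<Prod>b<d. 1 - fps_const (zeta d ^ (b * m)) * y) = (1 - y ^ (d div gcd d m)) ^ gcd d m"
proof -
  define g where "g = gcd d m"
  have "g > 0" using assms by (simp add: g_def)
  then obtain h k where hk: "d = h * g" "m = k * g" "coprime h k"
    unfolding g_def by (metis gcd_coprime_exists less_numeral_extra(3))
  have "h > 0" using assms hk by auto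
  \<comment> \<open>This is zeta_d^m after cancelling \<open>g\<close> from \<open>d\<close> and
    \<open>m\<close>; coprimality of \<open>h\<close> and \<open>k\<close> makes its first
    \<open>h\<close> powers distinct.\<close>
  define w where "w = fps_const (zeta h ^ k)"
  have w_power: "w ^ j = fps_const (zeta h ^ (k * j))" for j
    by (simp add: w_def fps_const_power power_mult)
  have w: "fps_const (zeta d ^ (b * m)) = w ^ b" for b
    using zeta_power_cancel[OF \<open>g > 0\<close>, of h "k * b"] hk by (simp add: w_power mult_ac)
  have "w ^ h = 1"
    using \<open>h > 0\<close> by (simp add: w_power power_mult mult.commute[of k])
  moreover have "inj_on (\<lambda>j. w ^ j) {..<h}"
  proof (rule inj_onI)
    fix i j assume "i \<in> {..<h}" "j \<in> {..<h}" "w ^ i = w ^ j"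
    then have "[k * i = k * j] (mod h)"
      using zeta_power_eq_iff[OF \<open>h > 0\<close>] by (simp add: w_power cong_def)
    then have "[i = j] (mod h)"
      using hk(3) by (simp add: cong_mult_lcancel_nat coprime_commute)
    with \<open>i \<in> {..<h}\<close> \<open>j \<in> {..<h}\<close> show "i = j" by (simp add: cong_def)
  qed
  ultimately have "(\<Prod>b<h. 1 - w ^ b * y) = 1 - y ^ h"
    using \<open>h > 0\<close> by (rule prod_one_minus_root_of_unity)
  moreover have "(\<Prod>b<g * h. 1 - w ^ b * y) = (\<Prod>b<h. 1 - w ^ b * y) ^ g"
    using \<open>w ^ h = 1\<close> by (intro prod_lessThan_periodic) (simp add: power_add)
  moreover have "d div g = h" using hk \<open>g > 0\<close> by simp
  moreover have "g * h = d" using hk by simp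
  ultimately show ?thesis by (simp only: w flip: g_def)
qed

subsection \<open>Hecke pairs\<close>

text \<open>The pair \<open>(a, b)\<close> stands for the matrix with rows \<open>(a, b)\<close> and \<open>(0, N div a)\<close>.\<close>

definition hecke_pairs :: "nat \<Rightarrow> (nat \<times> nat) set" where
  "hecke_pairs N = {(a, b). a dvd N \<and> b < N div a}"

definition primitive_pairs :: "nat \<Rightarrow> (nat \<times> nat) set" where
  "primitive_pairs N = {(a, b). a dvd N \<and> b < N div a \<and> gcd a (gcd b (N div a)) = 1}"

lemma hecke_pairs_eq_Sigma: "hecke_pairs N = (SIGMA a:{a. a dvd N}. {..<N div a})"
  by (auto simp: hecke_pairs_def)

lemma finite_hecke_pairs: "N > 0 \<Longrightarrow> finite (hecke_pairs N)"
  by (simp add: hecke_pairs_eq_Sigma)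

lemma card_hecke_pairs: "N > 0 \<Longrightarrow> card (hecke_pairs N) = (\<Sum>a | a dvd N. N div a)"
  by (simp add: hecke_pairs_eq_Sigma)

lemma hecke_pairs_memI: "N = a * d \<Longrightarrow> b < d \<Longrightarrow> a > 0 \<Longrightarrow> (a, b) \<in> hecke_pairs N"
  by (auto simp: hecke_pairs_def)

text \<open>Scaling the triple (a, b, d) by \<open>e\<close> multiplies the determinant by e^2 and
  the gcd by \<open>e\<close>. Dividing a Hecke pair by the gcd of its triple is therefore the
  inverse map.\<close>

lemma bij_betw_scaled_primitive_pairs:
  assumes "N > 0"
  shows "bij_betw (\<lambda>(e, a, b). (e * a, e * b))
           (SIGMA e:{e. e\<^sup>2 dvd N}. primitive_pairs (N div e\<^sup>2)) (hecke_pairs N)"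
proof (rule bij_betw_byWitness[where f' = "\<lambda>(a, b). let e = gcd a (gcd b (N div a)) in (e, a div e, b div e)"])
  \<comment> \<open>The second conjunct says that the inverse map reads off the right
    \<open>e\<close>.\<close>
  have scaled: "(e * a, e * b) \<in> hecke_pairs N \<and> gcd (e * a) (gcd (e * b) (N div (e * a))) = e"
    if "e\<^sup>2 dvd N" "(a, b) \<in> primitive_pairs (N div e\<^sup>2)" for e a b
  proof -
    from that obtain c where c: "N = e\<^sup>2 * c" by blast
    with assms have "e > 0" by (auto intro: Nat.gr0I)
    with c that have ab: "a dvd c" "b < c div a" "gcd a (gcd b (c div a)) = 1"
      by (auto simp: primitive_pairs_def)
    then obtain d where d: "c = a * d" by blast
    from c d assms have "a > 0" by (auto intro: Nat.gr0I)
    with d ab have bd: "b < d" "gcd a (gcd b d) = 1" by auto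
    have N: "N = (e * a) * (e * d)" using c d by (simp add: power2_eq_square)
    then have "N div (e * a) = e * d" using \<open>a > 0\<close> \<open>e > 0\<close> by simp
    then have "gcd (e * a) (gcd (e * b) (N div (e * a))) = e * gcd a (gcd b d)"
      by (simp only: gcd_mult_distrib_nat)
    with bd N \<open>a > 0\<close> \<open>e > 0\<close> show ?thesis
      by (auto intro: hecke_pairs_memI)
  qed
  have e_pos: "e > 0" if "e\<^sup>2 dvd N" for e
    using that assms by (auto intro: Nat.gr0I)
  show "\<forall>x\<in>SIGMA e:{e. e\<^sup>2 dvd N}. primitive_pairs (N div e\<^sup>2).
      (case case x of (e, a, b) \<Rightarrow> (e * a, e * b) of
        (a, b) \<Rightarrow> let e = gcd a (gcd b (N div a)) in (e, a div e, b div e)) = x"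
    using scaled e_pos by (auto simp: Let_def simp del: gcd_mult_distrib_nat)
  show "(\<lambda>(e, a, b). (e * a, e * b)) ` (SIGMA e:{e. e\<^sup>2 dvd N}. primitive_pairs (N div e\<^sup>2))
      \<subseteq> hecke_pairs N"
    using scaled by auto
  show "\<forall>x\<in>hecke_pairs N.
      (case case x of (a, b) \<Rightarrow> let e = gcd a (gcd b (N div a)) in (e, a div e, b div e) of
        (e, a, b) \<Rightarrow> (e * a, e * b)) = x"
    by (auto simp: Let_def) (meson dvd_mult_div_cancel gcd_dvd1 gcd_dvd2 dvd_trans)
  show "(\<lambda>(a, b). let e = gcd a (gcd b (N div a)) in (e, a div e, b div e)) ` hecke_pairs N
      \<subseteq> (SIGMA e:{e. e\<^sup>2 dvd N}. primitive_pairs (N div e\<^sup>2))"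
  proof (rule image_subsetI)
    fix x assume x: "x \<in> hecke_pairs N"
    obtain a b where xab: "x = (a, b)" by force
    with x have ab: "(a, b) \<in> hecke_pairs N" by simp
    define e where "e = gcd a (gcd b (N div a))"
    define a' where "a' = a div e"
    define b' where "b' = b div e"
    from ab obtain d where d: "N = a * d" by (auto simp: hecke_pairs_def)
    with assms have "a > 0" "d > 0" by auto
    with d ab have e: "e = gcd a (gcd b d)" and "b < d" by (auto simp: hecke_pairs_def e_def)
    have "e > 0" using e \<open>a > 0\<close> by auto
    have "e dvd a" "e dvd b" "e dvd d" by (auto simp: e intro: dvd_trans)
    then have a: "a = e * a'" and b: "b = e * b'" by (simp_all add: a'_def b'_def)
    from \<open>e dvd d\<close> obtain d' where d': "d = e * d'" by blast
    have "e * gcd a' (gcd b' d') = e" using e a b d' by (metis gcd_mult_distrib_nat)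
    then have "gcd a' (gcd b' d') = 1" using \<open>e > 0\<close> by simp
    moreover have N: "N = e\<^sup>2 * (a' * d')" using d a d' by (simp add: power2_eq_square)
    moreover have "b' < d'" using \<open>b < d\<close> b d' \<open>e > 0\<close> by simp
    moreover have "a' > 0" using \<open>a > 0\<close> a by auto
    ultimately have "(e, a', b') \<in> (SIGMA e:{e. e\<^sup>2 dvd N}. primitive_pairs (N div e\<^sup>2))"
      using \<open>e > 0\<close> by (auto simp: primitive_pairs_def)
    then show "(case x of (a, b) \<Rightarrow> let e = gcd a (gcd b (N div a)) in (e, a div e, b div e))
        \<in> (SIGMA e:{e. e\<^sup>2 dvd N}. primitive_pairs (N div e\<^sup>2))"
      by (simp add: xab a'_def b'_def e_def Let_def)
  qed
qed

lemma primitive_pairs_subset: "primitive_pairs N \<subseteq> hecke_pairs N"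
  by (auto simp: primitive_pairs_def hecke_pairs_def)

lemma finite_primitive_pairs: "N > 0 \<Longrightarrow> finite (primitive_pairs N)"
  using finite_subset[OF primitive_pairs_subset finite_hecke_pairs] .

lemma finite_square_divisors: "N > 0 \<Longrightarrow> finite {e :: nat. e\<^sup>2 dvd N}"
  by (rule finite_subset[of _ "{e. e dvd N}"]) (auto intro: dvd_trans[rotated])

lemma card_hecke_pairs_eq_sum_primitive:
  assumes "N > 0"
  shows "card (hecke_pairs N) = (\<Sum>e | e\<^sup>2 dvd N. card (primitive_pairs (N div e\<^sup>2)))"
proof -
  have "N div e\<^sup>2 > 0" if "e\<^sup>2 dvd N" for e
    using that assms by (auto elim!: dvdE)
  then show ?thesis
    using bij_betw_same_card[OF bij_betw_scaled_primitive_pairs[OF assms]] assms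
    by (simp add: finite_square_divisors finite_primitive_pairs)
qed

section \<open>Substitution of monomials and truncation of Euler factors\<close>

lemma fps_compose_monomial:
  fixes c :: "'a :: idom"
  assumes "j > 0"
  shows "(fps_const c * fps_X ^ k) oo fps_X ^ j = fps_const c * fps_X ^ (j * k)"
proof -
  have 0: "fps_nth (fps_X ^ j :: 'a fps) 0 = 0" using assms by simp
  have "fps_X ^ k oo fps_X ^ j = (fps_X ^ j :: 'a fps) ^ k"
    by (simp only: flip: fps_compose_power[OF 0]) (simp only: fps_X_fps_compose_startby0[OF 0])
  then show ?thesis
    by (simp only: fps_compose_mult_distrib[OF 0] fps_const_compose power_mult)
qed

lemma euler_prod_compose:
  assumes "k > 0"
  shows "euler_prod L oo (fps_const c * fps_X ^ k)
    = (\<Prod>m = 1..L. 1 - fps_const (c ^ m) * fps_X ^ (k * m))"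
proof -
  let ?u = "fps_const c * fps_X ^ k"
  have u0: "fps_nth ?u 0 = 0" using assms by simp
  have "fps_X ^ m oo ?u = fps_const (c ^ m) * fps_X ^ (k * m)" for m
    by (simp only: flip: fps_compose_power[OF u0])
       (simp only: fps_X_fps_compose_startby0[OF u0] power_mult_distrib fps_const_power power_mult)
  then show ?thesis
    by (simp add: euler_prod_def fps_compose_prod_distrib[OF u0] fps_compose_sub_distrib)
qed

lemma fps_eq_upto_one_minus_X_power:
  fixes f :: "'b \<Rightarrow> nat"
  assumes "finite I"
  shows "fps_eq_upto L (\<Prod>i\<in>I. (1 - fps_X ^ f i) ^ r i)
     (\<Prod>i\<in>{i\<in>I. f i < L}. (1 - fps_X ^ f i :: 'a :: comm_ring_1 fps) ^ r i)"
proof -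
  have "fps_eq_upto L (\<Prod>i\<in>I. (1 - fps_X ^ f i) ^ r i)
     (\<Prod>i\<in>I. if f i < L then (1 - fps_X ^ f i :: 'a fps) ^ r i else 1)"
  proof (rule fps_eq_upto_prod)
    fix i
    have "fps_eq_upto L ((1 - fps_X ^ f i :: 'a fps) ^ r i) (1 ^ r i)" if "\<not> f i < L"
      using that by (intro fps_eq_upto_power) (simp add: fps_eq_upto_def fps_X_power_iff)
    then show "fps_eq_upto L ((1 - fps_X ^ f i :: 'a fps) ^ r i)
        (if f i < L then (1 - fps_X ^ f i) ^ r i else 1)"
      by simp
  qed
  also have "(\<Prod>i\<in>I. if f i < L then (1 - fps_X ^ f i :: 'a fps) ^ r i else 1)
      = (\<Prod>i\<in>{i\<in>I. f i < L}. (1 - fps_X ^ f i :: 'a fps) ^ r i)"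
    using assms by (simp add: prod.inter_filter)
  finally show ?thesis .
qed

subsection \<open>The product over all Hecke pairs\<close>

text \<open>The factor of the theorem that belongs to (a, b) is the partition series with this
  monomial substituted for X.\<close>

definition monomial_at :: "nat \<Rightarrow> nat \<times> nat \<Rightarrow> complex fps" where
  "monomial_at N = (\<lambda>(a, b). fps_const (zeta N ^ (a * b)) * fps_X ^ a\<^sup>2)"

lemma monomial_at_nth_0: "N > 0 \<Longrightarrow> p \<in> hecke_pairs N \<Longrightarrow> fps_nth (monomial_at N p) 0 = 0"
  by (auto simp: monomial_at_def hecke_pairs_def intro!: Nat.gr0I)

lemma euler_prod_hecke_pairs_expand:
  assumes "N > 0"
  shows "(\<Prod>p\<in>hecke_pairs N. euler_prod L oo monomial_at N p)
    = (\<Prod>(a, m)\<in>{a. a dvd N} \<times> {1..L}.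
        (1 - fps_X ^ (a\<^sup>2 * m * (N div a div gcd (N div a) m))) ^ gcd (N div a) m)"
proof -
  have fin: "finite {a. a dvd N}" using assms by simp
  have inner: "(\<Prod>b<N div a. euler_prod L oo monomial_at N (a, b))
      = (\<Prod>m = 1..L. (1 - fps_X ^ (a\<^sup>2 * m * (N div a div gcd (N div a) m))) ^ gcd (N div a) m)"
    if "a dvd N" for a
  proof -
    from that obtain d where d: "N = a * d" by blast
    with assms have "a > 0" "d > 0" by auto
    \<comment> \<open>As N = a d, the coefficient zeta_N^(ab) equals zeta_d^b. Swapping the two
      products then makes the one over \<open>b\<close> innermost, where the root-of-unity identity
      applies.\<close>
    have "(\<Prod>b<d. euler_prod L oo monomial_at N (a, b))
        = (\<Prod>b<d. \<Prod>m = 1..L. 1 - fps_const (zeta d ^ (b * m)) * fps_X ^ (a\<^sup>2 * m))"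
      using \<open>a > 0\<close> zeta_power_cancel[OF \<open>a > 0\<close>, of d]
      by (simp add: monomial_at_def euler_prod_compose d mult.assoc flip: power_mult)
    also have "\<dots> = (\<Prod>m = 1..L. \<Prod>b<d. 1 - fps_const (zeta d ^ (b * m)) * fps_X ^ (a\<^sup>2 * m))"
      by (rule prod.swap)
    also have "\<dots> = (\<Prod>m = 1..L. (1 - fps_X ^ (a\<^sup>2 * m * (d div gcd d m))) ^ gcd d m)"
      by (simp only: prod_one_minus_zeta_power[OF \<open>d > 0\<close>] flip: power_mult)
    finally show ?thesis using d \<open>a > 0\<close> by simp
  qed
  have "(\<Prod>p\<in>hecke_pairs N. euler_prod L oo monomial_at N p)
     = (\<Prod>a\<in>{a. a dvd N}. \<Prod>b<N div a. euler_prod L oo monomial_at N (a, b))"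
    using fin by (simp add: hecke_pairs_eq_Sigma prod.Sigma)
  also have "\<dots> = (\<Prod>a\<in>{a. a dvd N}. \<Prod>m = 1..L.
      (1 - fps_X ^ (a\<^sup>2 * m * (N div a div gcd (N div a) m))) ^ gcd (N div a) m)"
    by (intro prod.cong refl inner) simp
  finally show ?thesis by (simp only: prod.cartesian_product)
qed

text \<open>With \<open>g = gcd (N div a) m\<close>, the new variables are \<open>s = N div g\<close> and \<open>M = a * m div g\<close>.\<close>

lemma prod_gcd_reindex:
  fixes F :: "nat \<Rightarrow> nat \<Rightarrow> 'a :: comm_monoid_mult"
  assumes "N > 0"
  shows "(\<Prod>(a, m)\<in>{(a, m) \<in> {a. a dvd N} \<times> {1..L}. a\<^sup>2 * m * (N div a div gcd (N div a) m) < L}.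
      F (a\<^sup>2 * m * (N div a div gcd (N div a) m)) (gcd (N div a) m))
    = (\<Prod>(s, M)\<in>{(s, M) \<in> {s. s dvd N} \<times> {1..L}. N * M < L}. F (N * M) (N div s))"
    (is "prod ?f ?A = prod ?g ?B")
proof (rule prod.reindex_bij_witness[where
    i = "\<lambda>(s, M). (gcd s M, M * (N div s) div gcd s M)" and
    j = "\<lambda>(a, m). (N div gcd (N div a) m, a * m div gcd (N div a) m)"])
  \<comment> \<open>Write d = h g and m = k g with \<open>h\<close>, \<open>k\<close> coprime. Then
    s = a h and M = a k, so gcd(s, M) = a and N/s = g, and the exponent a^2 m (d/g) is N M.\<close>
  have fwd: "\<exists>s M g. N div gcd (N div a) m = s \<and> a * m div gcd (N div a) m = M \<and>
        gcd (N div a) m = g \<and> (s, M) \<in> ?B \<and> gcd s M = a \<and> M * (N div s) div a = m \<and>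
        N div s = g \<and> a\<^sup>2 * m * (N div a div g) = N * M"
    if am: "(a, m) \<in> ?A" for a m
  proof -
    from am obtain d where d: "N = a * d" by auto
    with assms have pos: "a > 0" "d > 0" by auto
    define g where "g = gcd d m"
    have "g > 0" using pos by (simp add: g_def)
    then obtain h k where hk: "d = h * g" "m = k * g" "coprime h k"
      unfolding g_def by (metis gcd_coprime_exists less_numeral_extra(3))
    have "k > 0" "h > 0" using am hk pos by (auto intro!: Nat.gr0I)
    have "N div a = d" using d pos by simp
    moreover have N: "N = (a * h) * g" using d hk by simp
    then have "N div g = a * h" "N div (a * h) = g" using \<open>g > 0\<close> \<open>h > 0\<close> pos by simp_all
    moreover have "a * m div g = a * k" using hk \<open>g > 0\<close> by simp
    moreover have "gcd (a * h) (a * k) = a" using hk by (simp add: gcd_mult_left)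
    moreover have "a * k * g div a = m" using hk pos by simp
    moreover have eq: "a\<^sup>2 * m * (d div g) = N * (a * k)"
      using hk N \<open>g > 0\<close> by (simp add: power2_eq_square mult_ac)
    \<comment> \<open>The cutoff N M < L already forces M \<le> L, so the range of \<open>M\<close>
      causes no loss; the converse direction bounds \<open>m\<close> in the same way.\<close>
    moreover have "(a * h, a * k) \<in> ?B"
    proof -
      have lt: "N * (a * k) < L" using am eq \<open>N div a = d\<close> by (simp add: g_def)
      moreover have "a * k \<le> N * (a * k)" using assms by simp
      ultimately have "a * k \<le> L" by linarith
      with lt N \<open>k > 0\<close> pos show ?thesis by simp
    qed
    ultimately show ?thesis unfolding g_def[symmetric] by (auto simp flip: g_def)
  qed
  \<comment> \<open>Here N = s g, and s = h a, M = k a with \<open>h\<close>, \<open>k\<close>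
    coprime; hence N/a = h g and m = k g, whose gcd is g.\<close>
  have bwd: "\<exists>a m g. gcd s M = a \<and> M * (N div s) div gcd s M = m \<and> (a, m) \<in> ?A \<and>
      gcd (N div a) m = g \<and> N div g = s \<and> a * m div g = M"
    if sM: "(s, M) \<in> ?B" for s M
  proof -
    from sM obtain g where g: "N = s * g" by auto
    with assms have pos: "s > 0" "g > 0" by auto
    define a where "a = gcd s M"
    have "a > 0" using pos by (simp add: a_def)
    then obtain h k where hk: "s = h * a" "M = k * a" "coprime h k"
      unfolding a_def by (metis gcd_coprime_exists less_numeral_extra(3))
    have "k > 0" "h > 0" using sM hk pos by (auto intro!: Nat.gr0I)
    have N: "N = a * (h * g)" using g hk by simp
    then have Na: "N div a = h * g" using \<open>a > 0\<close> by simp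
    have m: "M * (N div s) div a = k * g" using hk g pos by simp
    have gcd: "gcd (h * g) (k * g) = g"
      using hk(3) by (metis coprime_imp_gcd_eq_1 gcd_mult_distrib_nat mult.commute mult.right_neutral)
    have "N div g = s" using g pos by simp
    moreover have "a * (k * g) div g = M" using hk pos by simp
    moreover have "(a, k * g) \<in> ?A"
    proof -
      have "a\<^sup>2 * (k * g) * h = N * M"
        using hk N by (simp add: power2_eq_square mult_ac)
      then have lt: "a\<^sup>2 * (k * g) * h < L" using sM by simp
      have "k * g \<le> (k * g) * (a * a * h)" using \<open>a > 0\<close> \<open>h > 0\<close> by simp
      also have "\<dots> = N * M" using N hk by (simp add: mult_ac)
      also have "N * M < L" using sM by simp
      finally have "k * g \<le> L" by simp
      then show ?thesis using lt \<open>k > 0\<close> pos N by (simp add: Na gcd)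
    qed
    ultimately show ?thesis using Na m gcd unfolding a_def[symmetric] by auto
  qed
  show "(case case x of (a, m) \<Rightarrow> (N div gcd (N div a) m, a * m div gcd (N div a) m) of
      (s, M) \<Rightarrow> (gcd s M, M * (N div s) div gcd s M)) = x" if "x \<in> ?A" for x
    using fwd[of "fst x" "snd x"] that assms by (cases x) (auto intro!: Nat.gr0I)
  show "(case x of (a, m) \<Rightarrow> (N div gcd (N div a) m, a * m div gcd (N div a) m)) \<in> ?B"
    if "x \<in> ?A" for x
    using fwd[of "fst x" "snd x"] that by (cases x) (simp only: split fst_conv snd_conv, blast)
  show "(case case x of (s, M) \<Rightarrow> (gcd s M, M * (N div s) div gcd s M) of
      (a, m) \<Rightarrow> (N div gcd (N div a) m, a * m div gcd (N div a) m)) = x" if "x \<in> ?B" for x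
    using bwd[of "fst x" "snd x"] that assms by (cases x) (auto intro!: Nat.gr0I)
  show "(case x of (s, M) \<Rightarrow> (gcd s M, M * (N div s) div gcd s M)) \<in> ?A"
    if "x \<in> ?B" for x
    using bwd[of "fst x" "snd x"] that by (cases x) (simp only: split fst_conv snd_conv, blast)
  show "?g (case x of (a, m) \<Rightarrow> (N div gcd (N div a) m, a * m div gcd (N div a) m)) = ?f x"
    if "x \<in> ?A" for x
    using fwd[of "fst x" "snd x"] that assms by (cases x) (auto intro!: Nat.gr0I)
qed

text \<open>The reindexing need not map the box m \<le> L into M \<le> L, but it matches the factors
  with exponent below \<open>L\<close>. Both finite products are therefore first truncated to
  these.\<close>

lemma euler_prod_hecke_pairs:
  assumes "N > 0"
  shows "fps_eq_upto L (\<Prod>p\<in>hecke_pairs N. euler_prod L oo monomial_at N p)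
    ((euler_prod L oo fps_X ^ N) ^ card (hecke_pairs N))"
proof -
  define A where "A = {a. a dvd N} \<times> {1..L}"
  define e where "e x = (fst x)\<^sup>2 * snd x * (N div fst x div gcd (N div fst x) (snd x))" for x
  define r where "r x = gcd (N div fst x) (snd x)" for x
  have fin: "finite A" using assms by (simp add: A_def)
  have 1: "(\<Prod>p\<in>hecke_pairs N. euler_prod L oo monomial_at N p) = (\<Prod>x\<in>A. (1 - fps_X ^ e x) ^ r x)"
    by (simp only: euler_prod_hecke_pairs_expand[OF assms] case_prod_unfold A_def e_def r_def)
  have 2: "fps_eq_upto L (\<Prod>x\<in>A. (1 - fps_X ^ e x) ^ r x)
      (\<Prod>x\<in>{x\<in>A. e x < L}. (1 - fps_X ^ e x :: complex fps) ^ r x)"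
    by (rule fps_eq_upto_one_minus_X_power[OF fin])
  have 3: "(\<Prod>x\<in>{x\<in>A. e x < L}. (1 - fps_X ^ e x :: complex fps) ^ r x)
      = (\<Prod>x\<in>{x\<in>A. N * snd x < L}. (1 - fps_X ^ (N * snd x)) ^ (N div fst x))"
    using prod_gcd_reindex[OF assms, where L = L and F = "\<lambda>n r. (1 - fps_X ^ n :: complex fps) ^ r"]
    by (simp only: case_prod_unfold A_def e_def r_def Collect_mem_eq prod.collapse)
  have 4: "fps_eq_upto L (\<Prod>x\<in>A. (1 - fps_X ^ (N * snd x)) ^ (N div fst x))
      (\<Prod>x\<in>{x\<in>A. N * snd x < L}. (1 - fps_X ^ (N * snd x) :: complex fps) ^ (N div fst x))"
    by (rule fps_eq_upto_one_minus_X_power[OF fin])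
  \<comment> \<open>For each divisor \<open>s\<close> the product over \<open>M\<close> is the same
    Euler product in X^N, raised to N/s; these exponents add up to the number of Hecke
    pairs.\<close>
  have 5: "(\<Prod>x\<in>A. (1 - fps_X ^ (N * snd x)) ^ (N div fst x))
      = (euler_prod L oo fps_X ^ N) ^ card (hecke_pairs N)"
  proof -
    have "(\<Prod>x\<in>A. (1 - fps_X ^ (N * snd x)) ^ (N div fst x))
        = (\<Prod>s\<in>{s. s dvd N}. (\<Prod>M = 1..L. 1 - fps_X ^ (N * M) :: complex fps) ^ (N div s))"
      unfolding A_def prod.cartesian_product' prod_power_distrib by simp
    also have "(\<Prod>M = 1..L. 1 - fps_X ^ (N * M)) = euler_prod L oo fps_X ^ N"
      using euler_prod_compose[OF assms, of L 1] by simp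
    finally show ?thesis
      by (simp only: card_hecke_pairs[OF assms] power_sum)
  qed
  show ?thesis
    unfolding 1 5[symmetric]
    by (rule fps_eq_upto_trans[OF 2[unfolded 3] fps_eq_upto_sym[OF 4]])
qed

lemma fps_eq_upto_partition_euler_compose:
  assumes "fps_nth u 0 = 0"
  shows "fps_eq_upto L ((partition_fps oo u) * (euler_prod L oo u)) 1"
proof -
  have "fps_eq_upto L (partition_fps * euler_prod L) 1"
    using partition_euler_prod[of L] by (simp add: fps_eq_upto_def)
  from fps_eq_upto_compose[OF this, of u] show ?thesis
    by (simp add: fps_compose_mult_distrib[OF assms])
qed

text \<open>Modulo X^L, \<open>?E\<close> is inverse to \<open>?P\<close> and \<open>?F\<close> to
  \<open>?Q\<close>. Since \<open>?E\<close> and \<open>?F\<close> are congruent, so are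
  \<open>?P\<close> and \<open>?Q\<close>, via P = PQF = QPE = Q.\<close>

lemma partition_fps_hecke_pairs:
  assumes "N > 0"
  shows "(\<Prod>p\<in>hecke_pairs N. partition_fps oo monomial_at N p)
    = (partition_fps oo fps_X ^ N) ^ card (hecke_pairs N)" (is "?P = ?Q")
proof (rule fps_eq_upto_imp_eq)
  fix L
  let ?D = "hecke_pairs N"
  let ?E = "\<Prod>p\<in>?D. euler_prod L oo monomial_at N p"
  let ?F = "(euler_prod L oo fps_X ^ N) ^ card ?D"
  have "fps_eq_upto L (?P * ?E) (\<Prod>p\<in>?D. 1)"
    unfolding prod.distrib[symmetric]
    by (intro fps_eq_upto_prod fps_eq_upto_partition_euler_compose monomial_at_nth_0[OF assms])
  then have PE: "fps_eq_upto L (?P * ?E) 1" by simp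
  have "fps_nth (fps_X ^ N :: complex fps) 0 = 0" using assms by simp
  from fps_eq_upto_power[OF fps_eq_upto_partition_euler_compose[OF this, of L], of "card ?D"]
  have QF: "fps_eq_upto L (?Q * ?F) 1" by (simp add: power_mult_distrib)
  have EF: "fps_eq_upto L ?E ?F" by (rule euler_prod_hecke_pairs[OF assms])
  have "fps_eq_upto L (?P * 1) (?P * (?Q * ?F))"
    by (intro fps_eq_upto_mult fps_eq_upto_sym[OF QF] fps_eq_upto_refl)
  also have "?P * (?Q * ?F) = ?Q * ?P * ?F" by (simp only: mult_ac)
  also have "fps_eq_upto L \<dots> (?Q * ?P * ?E)"
    by (intro fps_eq_upto_mult fps_eq_upto_sym[OF EF] fps_eq_upto_refl)
  also have "?Q * ?P * ?E = ?Q * (?P * ?E)" by (simp only: mult.assoc)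
  also have "fps_eq_upto L \<dots> (?Q * 1)"
    by (intro fps_eq_upto_mult PE fps_eq_upto_refl)
  finally show "fps_eq_upto L ?P ?Q" by simp
qed

subsection \<open>Reduction to primitive pairs\<close>

lemma monomial_at_scaled:
  assumes "e > 0"
  shows "monomial_at n (a, b) oo fps_X ^ e\<^sup>2 = monomial_at (e\<^sup>2 * n) (e * a, e * b)"
proof -
  have "e\<^sup>2 > 0" using assms by simp
  have "zeta (e\<^sup>2 * n) ^ (e * a * (e * b)) = zeta n ^ (a * b)"
    using zeta_power_cancel[OF \<open>e\<^sup>2 > 0\<close>, of n "a * b"] by (simp add: power2_eq_square mult_ac)
  then show ?thesis
    using fps_compose_monomial[OF \<open>e\<^sup>2 > 0\<close>]
    by (simp add: monomial_at_def power_mult_distrib)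
qed

text \<open>The pairs of gcd \<open>e\<close> contribute the primitive product of level N/e^2 with X
  replaced by X^(e^2), because zeta_N^(e^2 ab) is the root zeta^(ab) of the lower level.\<close>

lemma partition_fps_primitive_pairs_scaled:
  assumes "N > 0" "e\<^sup>2 dvd N"
  shows "(\<Prod>(a, b)\<in>primitive_pairs (N div e\<^sup>2). partition_fps oo monomial_at N (e * a, e * b))
    = (\<Prod>p\<in>primitive_pairs (N div e\<^sup>2). partition_fps oo monomial_at (N div e\<^sup>2) p) oo fps_X ^ e\<^sup>2"
proof -
  from assms obtain n where n: "N = e\<^sup>2 * n" by blast
  with assms have "e > 0" "n > 0" by (auto intro!: Nat.gr0I)
  have X0: "fps_nth (fps_X ^ e\<^sup>2 :: complex fps) 0 = 0" using \<open>e > 0\<close> by simp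
  have "partition_fps oo monomial_at N (e * fst p, e * snd p)
      = (partition_fps oo monomial_at n p) oo fps_X ^ e\<^sup>2" if "p \<in> primitive_pairs n" for p
  proof -
    have m0: "fps_nth (monomial_at n p) 0 = 0"
      using that \<open>n > 0\<close> primitive_pairs_subset by (blast intro: monomial_at_nth_0)
    then show ?thesis
      using monomial_at_scaled[OF \<open>e > 0\<close>, of n "fst p" "snd p"]
      by (simp add: n flip: fps_compose_assoc[OF X0 m0])
  qed
  moreover have "N div e\<^sup>2 = n" using n \<open>e > 0\<close> by simp
  ultimately show ?thesis
    by (simp add: case_prod_unfold fps_compose_prod_distrib[OF X0])
qed

lemma prod_hecke_pairs_eq_primitive:
  fixes f :: "nat \<times> nat \<Rightarrow> 'a :: comm_monoid_mult"
  assumes "N > 0"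
  shows "(\<Prod>p\<in>hecke_pairs N. f p)
    = (\<Prod>e | e\<^sup>2 dvd N. \<Prod>(a, b)\<in>primitive_pairs (N div e\<^sup>2). f (e * a, e * b))"
proof -
  have "N div e\<^sup>2 > 0" if "e\<^sup>2 dvd N" for e
    using that assms by (auto elim!: dvdE)
  then have fin: "\<forall>e\<in>{e. e\<^sup>2 dvd N}. finite (primitive_pairs (N div e\<^sup>2))"
    by (simp add: finite_primitive_pairs)
  show ?thesis
    using prod.reindex_bij_betw[OF bij_betw_scaled_primitive_pairs[OF assms], of f]
    by (simp add: prod.Sigma[OF finite_square_divisors[OF assms] fin] case_prod_unfold)
qed

text \<open>In the identity for all Hecke pairs, the terms with e > 1 are powers of
  \<open>?Q\<close> by induction. Cancelling them leaves e = 1, the primitive pairs of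
  \<open>N\<close> itself.\<close>

lemma partition_fps_primitive_pairs:
  assumes "N > 0"
  shows "(\<Prod>p\<in>primitive_pairs N. partition_fps oo monomial_at N p)
    = (partition_fps oo fps_X ^ N) ^ card (primitive_pairs N)"
  using assms
proof (induction N rule: less_induct)
  case (less N)
  let ?c = "\<lambda>e. card (primitive_pairs (N div e\<^sup>2))"
  let ?P = "\<lambda>N. \<Prod>p\<in>primitive_pairs N. partition_fps oo monomial_at N p"
  let ?Q = "partition_fps oo fps_X ^ N"
  define S where "S = {e. e\<^sup>2 dvd N} - {1}"
  have fin: "finite S" using finite_square_divisors[OF less.prems] by (simp add: S_def)
  have S: "{e. e\<^sup>2 dvd N} = insert 1 S" "1 \<notin> S" by (auto simp: S_def)
  have step: "?P (N div e\<^sup>2) oo fps_X ^ e\<^sup>2 = ?Q ^ ?c e" if "e \<in> S" for e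
  proof -
    from that obtain n where n: "N = e\<^sup>2 * n" by (auto simp: S_def)
    with less.prems have "e > 0" "n > 0" by (auto intro!: Nat.gr0I)
    with that have "e > 1" by (auto simp: S_def)
    then have "e\<^sup>2 > 1" by (intro one_less_power) simp_all
    with n \<open>n > 0\<close> have "n < N" by simp
    have X0: "fps_nth (fps_X ^ j :: complex fps) 0 = 0" if "j > 0" for j using that by simp
    have "e\<^sup>2 > 0" using \<open>e > 0\<close> by simp
    \<comment> \<open>Replacing X by X^(e^2) lifts the right-hand side of level \<open>n\<close> to
      the series in X^N, so every \<open>e\<close> yields a power of the same
      \<open>?Q\<close>.\<close>
    have "fps_X ^ n oo fps_X ^ e\<^sup>2 = (fps_X ^ N :: complex fps)"
      using fps_compose_monomial[OF \<open>e\<^sup>2 > 0\<close>, of 1 n] by (simp add: n)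
    then have "(partition_fps oo fps_X ^ n) oo fps_X ^ e\<^sup>2 = ?Q"
      using fps_compose_assoc[OF X0[OF \<open>e\<^sup>2 > 0\<close>] X0[OF \<open>n > 0\<close>], of partition_fps] by simp
    moreover have "N div e\<^sup>2 = n" using n \<open>e > 0\<close> by simp
    ultimately show ?thesis
      using less.IH[OF \<open>n < N\<close> \<open>n > 0\<close>] by (simp flip: fps_compose_power[OF X0[OF \<open>e\<^sup>2 > 0\<close>]])
  qed
  have "?P N * ?Q ^ (\<Sum>e\<in>S. ?c e) = ?P N * (\<Prod>e\<in>S. ?P (N div e\<^sup>2) oo fps_X ^ e\<^sup>2)"
    using step by (simp add: power_sum)
  also have "\<dots> = (\<Prod>e | e\<^sup>2 dvd N. ?P (N div e\<^sup>2) oo fps_X ^ e\<^sup>2)"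
    using fin S by simp
  also have "\<dots> = (\<Prod>p\<in>hecke_pairs N. partition_fps oo monomial_at N p)"
    using partition_fps_primitive_pairs_scaled[OF less.prems]
    by (simp add: prod_hecke_pairs_eq_primitive[OF less.prems])
  also have "\<dots> = ?Q ^ (\<Sum>e | e\<^sup>2 dvd N. ?c e)"
    using less.prems by (simp add: partition_fps_hecke_pairs card_hecke_pairs_eq_sum_primitive)
  also have "\<dots> = ?Q ^ ?c 1 * ?Q ^ (\<Sum>e\<in>S. ?c e)"
    using fin S by (simp add: power_add)
  finally have "?P N * ?Q ^ (\<Sum>e\<in>S. ?c e) = ?Q ^ ?c 1 * ?Q ^ (\<Sum>e\<in>S. ?c e)" .
  \<comment> \<open>Cancellation needs a nonzero factor; the constant term of \<open>?Q\<close> is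
    p(0) = 1.\<close>
  moreover have "?Q \<noteq> 0"
  proof
    assume "?Q = 0"
    then have "fps_nth ?Q 0 = 0" by simp
    then show False by (simp add: partition_fps_def partition_number_0)
  qed
  ultimately show ?case by simp
qed

subsection \<open>The number of primitive pairs\<close>

text \<open>The square part is a multiple e f of \<open>e\<close>; then f^2 divides the squarefree
  \<open>s\<close>, so f = 1. This is uniqueness of the decomposition t = e^2 s.\<close>

lemma square_part_square_mult:
  fixes e s :: nat
  assumes "squarefree s" "e > 0"
  shows "square_part (e\<^sup>2 * s) = e" and "squarefree_part (e\<^sup>2 * s) = s"
proof -
  have "s > 0" using assms by (auto intro!: Nat.gr0I)
  have "e dvd square_part (e\<^sup>2 * s)" by (simp add: dvd_square_part_iff)
  then obtain f where f: "square_part (e\<^sup>2 * s) = e * f" by blast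
  have "(e * f)\<^sup>2 dvd e\<^sup>2 * s" by (simp flip: f)
  then have "f\<^sup>2 dvd s" using assms(2) by (simp add: power_mult_distrib)
  then have "f = 1" using squarefreeD[OF assms(1)] by simp
  with f show *: "square_part (e\<^sup>2 * s) = e" by simp
  then show "squarefree_part (e\<^sup>2 * s) = s"
    using assms(2) \<open>s > 0\<close> by (simp add: squarefree_part_def)
qed

lemma sum_divisors_eq_sum_squarefree:
  fixes N :: nat
  assumes "N > 0"
  shows "(\<Sum>t | t dvd N. N div t)
    = (\<Sum>e | e\<^sup>2 dvd N. \<Sum>s | squarefree s \<and> s dvd N div e\<^sup>2. N div e\<^sup>2 div s)"
proof -
  let ?S = "SIGMA e:{e. e\<^sup>2 dvd N}. {s. squarefree s \<and> s dvd N div e\<^sup>2}"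
  have pos: "e > 0" "N div e\<^sup>2 > 0" if "e\<^sup>2 dvd N" for e
    using that assms by (auto elim!: dvdE intro!: Nat.gr0I)
  have "(\<Sum>t | t dvd N. N div t) = (\<Sum>(e, s)\<in>?S. N div e\<^sup>2 div s)"
  proof (rule sum.reindex_bij_witness[where
      i = "\<lambda>(e, s). e\<^sup>2 * s" and j = "\<lambda>t. (square_part t, squarefree_part t)"])
    fix t assume "t \<in> {t. t dvd N}"
    then have t: "t dvd N" "t = (square_part t)\<^sup>2 * squarefree_part t"
      by (simp_all add: mult.commute flip: squarefree_decompose)
    show "(case (square_part t, squarefree_part t) of (e, s) \<Rightarrow> e\<^sup>2 * s) = t"
      using t(2) by simp
    have sq: "(square_part t)\<^sup>2 dvd N" using t by (metis dvd_mult_left)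
    moreover have "squarefree_part t dvd N div (square_part t)\<^sup>2"
      using t sq pos(1)[OF sq] by (metis dvd_mult_imp_div mult.commute)
    ultimately show "(square_part t, squarefree_part t) \<in> ?S" by simp
    show "(case (square_part t, squarefree_part t) of (e, s) \<Rightarrow> N div e\<^sup>2 div s) = N div t"
      using t(2) by (simp flip: div_mult2_eq)
  next
    fix x assume "x \<in> ?S"
    then obtain e s where x: "x = (e, s)" "e\<^sup>2 dvd N" "squarefree s" "s dvd N div e\<^sup>2" by auto
    then show "(square_part (case x of (e, s) \<Rightarrow> e\<^sup>2 * s),
        squarefree_part (case x of (e, s) \<Rightarrow> e\<^sup>2 * s)) = x"
      using pos(1)[OF x(2)] by (simp add: square_part_square_mult)
    show "(case x of (e, s) \<Rightarrow> e\<^sup>2 * s) \<in> {t. t dvd N}"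
      using x by (metis case_prod_conv dvd_div_iff_mult dvd_triv_left mem_Collect_eq mult.commute
          mult_eq_0_iff pos(1) power2_eq_square less_irrefl)
  qed
  also have "\<dots> = (\<Sum>e | e\<^sup>2 dvd N. \<Sum>s | squarefree s \<and> s dvd N div e\<^sup>2. N div e\<^sup>2 div s)"
  proof (rule sum.Sigma[symmetric])
    show "\<forall>e\<in>{e. e\<^sup>2 dvd N}. finite {s. squarefree s \<and> s dvd N div e\<^sup>2}"
      using pos(2) by (auto intro: finite_subset[OF _ finite_divisors_nat])
  qed (rule finite_square_divisors[OF assms])
  finally show ?thesis .
qed

text \<open>Summed over all \<open>e\<close> with e^2 dividing N, both sides at level N/e^2 total
  sigma(N). By induction they agree for e > 1, hence also for e = 1.\<close>

lemma card_primitive_pairs: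
  assumes "N > 0"
  shows "card (primitive_pairs N) = (\<Sum>s | squarefree s \<and> s dvd N. N div s)"
  using assms
proof (induction N rule: less_induct)
  case (less N)
  let ?F = "\<lambda>N. \<Sum>s | squarefree s \<and> s dvd N. N div s"
  define S where "S = {e. e\<^sup>2 dvd N} - {1}"
  have fin: "finite S" using finite_square_divisors[OF less.prems] by (simp add: S_def)
  have S: "{e. e\<^sup>2 dvd N} = insert 1 S" "1 \<notin> S" by (auto simp: S_def)
  have "card (primitive_pairs (N div e\<^sup>2)) = ?F (N div e\<^sup>2)" if "e \<in> S" for e
  proof -
    from that obtain n where n: "N = e\<^sup>2 * n" by (auto simp: S_def)
    with less.prems have "e > 0" "n > 0" by (auto intro!: Nat.gr0I)
    with that have "e > 1" by (auto simp: S_def)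
    then have "e\<^sup>2 > 1" by (intro one_less_power) simp_all
    with n \<open>n > 0\<close> \<open>e > 0\<close> have "N div e\<^sup>2 < N" "N div e\<^sup>2 > 0" by simp_all
    then show ?thesis by (rule less.IH)
  qed
  then have "(\<Sum>e\<in>S. card (primitive_pairs (N div e\<^sup>2))) = (\<Sum>e\<in>S. ?F (N div e\<^sup>2))"
    by (rule sum.cong[OF refl])
  moreover have "(\<Sum>e | e\<^sup>2 dvd N. card (primitive_pairs (N div e\<^sup>2)))
      = (\<Sum>e | e\<^sup>2 dvd N. ?F (N div e\<^sup>2))"
    using sum_divisors_eq_sum_squarefree[OF less.prems] card_hecke_pairs[OF less.prems]
      card_hecke_pairs_eq_sum_primitive[OF less.prems] by simp
  ultimately show ?case using fin S by simp
qed

text \<open>A squarefree divisor is the product of its prime factors, all of multiplicity 1, so it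
  is determined by a subset of the primes dividing \<open>N\<close>.\<close>

lemma sum_squarefree_divisors:
  fixes f :: "nat \<Rightarrow> 'a :: comm_monoid_add"
  assumes "N > 0"
  shows "(\<Sum>s | squarefree s \<and> s dvd N. f s) = (\<Sum>A\<in>Pow (prime_factors N). f (\<Prod>A))"
proof (rule sum.reindex_bij_witness[where i = "\<lambda>A. \<Prod>A" and j = prime_factors])
  fix s assume "s \<in> {s. squarefree s \<and> s dvd N}"
  then have s: "squarefree s" "s dvd N" "s \<noteq> 0" using assms by auto
  have "s = (\<Prod>p\<in>prime_factors s. p ^ multiplicity p s)"
    using s(3) by (simp add: prod_prime_factors)
  also have "\<dots> = \<Prod>(prime_factors s)"
    using s squarefree_factorial_semiring'[of s] by (intro prod.cong) auto
  finally show *: "\<Prod>(prime_factors s) = s" by simp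
  show "prime_factors s \<in> Pow (prime_factors N)"
    using s assms by (auto intro: dvd_prime_factors[THEN subsetD])
  show "f (\<Prod>(prime_factors s)) = f s" by (simp only: *)
next
  fix A assume "A \<in> Pow (prime_factors N)"
  then have A: "A \<subseteq> prime_factors N" "finite A" "\<And>p. p \<in> A \<Longrightarrow> prime p"
    by (auto intro: finite_subset)
  show "prime_factors (\<Prod>A) = A"
    using A by (subst prime_factors_prod) (auto simp: prime_prime_factors)
  have "squarefree (\<Prod>A)"
    using A(3) by (intro squarefree_prod_coprime) (auto intro: primes_coprime squarefree_prime)
  moreover have "\<Prod>A dvd N"
  proof -
    have "\<Prod>A dvd \<Prod>(prime_factors N)"
      using A(1) by (intro prod_dvd_prod_subset) auto
    also have "\<dots> dvd (\<Prod>p\<in>prime_factors N. p ^ multiplicity p N)"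
      by (intro prod_dvd_prod dvd_power) (auto simp: prime_factors_multiplicity)
    also have "\<dots> = N" using assms by (simp add: prod_prime_factors)
    finally show ?thesis .
  qed
  ultimately show "\<Prod>A \<in> {s. squarefree s \<and> s dvd N}" by simp
qed

text \<open>Expanding the product of 1 + 1/p gives one term 1/s for each set of primes, that is, for
  each squarefree divisor \<open>s\<close>.\<close>

lemma real_card_primitive_pairs:
  assumes "N > 0"
  shows "real (card (primitive_pairs N)) = real N * (\<Prod>p\<in>prime_factors N. 1 + 1 / real p)"
proof -
  have "real (card (primitive_pairs N)) = (\<Sum>s | squarefree s \<and> s dvd N. real N * (1 / real s))"
    by (simp add: card_primitive_pairs[OF assms] real_of_nat_div)
  also have "\<dots> = real N * (\<Sum>A\<in>Pow (prime_factors N). \<Prod>p\<in>A. 1 / real p)"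
    by (simp add: sum_squarefree_divisors[OF assms] sum_distrib_left prod_dividef)
  also have "(\<Sum>A\<in>Pow (prime_factors N). \<Prod>p\<in>A. 1 / real p)
      = (\<Prod>p\<in>prime_factors N. 1 / real p + 1)"
    by (subst prod_add) simp_all
  finally show ?thesis by (simp add: add.commute)
qed

subsection \<open>The matrices\<close>

text \<open>The entry \<open>d\<close> is determined by a d = N, so the first row encodes the
  matrix; all entries are nonnegative, which permits natural numbers.\<close>

lemma bij_betw_cyclic_matrices:
  assumes "N > 0"
  shows "bij_betw (\<lambda>(a, b). vector [vector [int a, int b], vector [0, int (N div a)]])
           (primitive_pairs N) (cyclic_matrices N)"
  unfolding bij_betw_def
proof
  let ?f = "\<lambda>(a, b). vector [vector [int a, int b], vector [0, int (N div a)]] :: int ^ 2 ^ 2"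
  show "inj_on ?f (primitive_pairs N)"
  proof (rule inj_onI)
    fix p q assume "?f p = ?f q"
    then have "?f p $ 1 $ 1 = ?f q $ 1 $ 1" "?f p $ 1 $ 2 = ?f q $ 1 $ 2" by simp_all
    then show "p = q" by (simp add: case_prod_unfold prod_eq_iff)
  qed
  have "\<exists>a b. M = ?f (a, b) \<and> (a, b) \<in> primitive_pairs N" if M: "M \<in> cyclic_matrices N" for M
  proof -
    from M obtain a b d where abd: "M = vector [vector [a, b], vector [0, d]]" "a * d = int N"
      "1 \<le> a" "0 \<le> b" "b \<le> d - 1" "gcd a (gcd b d) = 1"
      unfolding cyclic_matrices_def by (elim CollectE exE conjE) (rule that)
    from abd(3-5) have "a \<ge> 0" "b \<ge> 0" "d \<ge> 0" by simp_all
    then obtain a' b' d' where nat: "a = int a'" "b = int b'" "d = int d'"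
      by (metis zero_le_imp_eq_int)
    have N: "a' * d' = N" using abd(2) nat by (metis of_nat_eq_iff of_nat_mult)
    then have "N div a' = d'" "a' dvd N" using abd(3) nat by auto
    moreover have "gcd a' (gcd b' d') = 1" using abd(6) nat by simp
    ultimately have "(a', b') \<in> primitive_pairs N"
      using N abd nat by (auto simp: primitive_pairs_def)
    moreover have "M = ?f (a', b')" using abd(1) nat \<open>N div a' = d'\<close> by simp
    ultimately show ?thesis by blast
  qed
  moreover have "?f (a, b) \<in> cyclic_matrices N" if "(a, b) \<in> primitive_pairs N" for a b
  proof -
    from that obtain d where d: "N = a * d" by (auto simp: primitive_pairs_def)
    with assms have "a > 0" "d > 0" by auto
    with that d have "b < d" "gcd a (gcd b d) = 1" by (auto simp: primitive_pairs_def)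
    moreover from this have "gcd (int a) (gcd (int b) (int d)) = 1" by simp
    ultimately show ?thesis
      unfolding cyclic_matrices_def using d \<open>a > 0\<close>
      by (intro CollectI exI[of _ "int a"] exI[of _ "int b"] exI[of _ "int d"]) simp
  qed
  ultimately show "?f ` primitive_pairs N = cyclic_matrices N" by fast
qed

theorem theorem1p1:
  fixes N :: nat
  assumes "N \<ge> 1"
  shows
    "real (psi N) = real N * (\<Prod>p \<in> prime_factors N. 1 + 1 / real p) \<and>
     (\<Prod>M \<in> cyclic_matrices N.
        let a = M $ 1 $ 1; b = M $ 1 $ 2 in
          1 + (\<Sum>n. fps_const (zeta N powi (a * b * int (Suc n)) * of_nat (partition_number (Suc n)))
                      * fps_X ^ nat (a\<^sup>2 * int (Suc n))))
       = (1 + (\<Sum>n. fps_const (of_nat (partition_number (Suc n))) * fps_X ^ (N * Suc n))) ^ psi N"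
proof
  have N: "N > 0" using assms by simp
  note bij = bij_betw_cyclic_matrices[OF N]
  have psi: "psi N = card (primitive_pairs N)"
    using bij_betw_same_card[OF bij] by (simp add: psi_def)
  then show "real (psi N) = real N * (\<Prod>p \<in> prime_factors N. 1 + 1 / real p)"
    by (simp add: real_card_primitive_pairs[OF N])
  let ?h = "\<lambda>a b. 1 + (\<Sum>n. fps_const (zeta N powi (a * b * int (Suc n)) *
      of_nat (partition_number (Suc n))) * fps_X ^ nat (a\<^sup>2 * int (Suc n)))"
  have h: "?h (int a) (int b) = partition_fps oo monomial_at N (a, b)"
    if "(a, b) \<in> primitive_pairs N" for a b
  proof -
    have "a > 0" using that N by (auto simp: primitive_pairs_def intro!: Nat.gr0I)
    then have "a\<^sup>2 > 0" by simp
    \<comment> \<open>The integer exponents are images of natural numbers, so \<open>powi\<close>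
      and \<open>nat\<close> reduce to ordinary powers of the coefficient in
      \<open>monomial_at\<close>.\<close>
    have "zeta N powi (int a * int b * int (Suc n)) = (zeta N ^ (a * b)) ^ Suc n" for n
      by (metis of_nat_mult power_int_of_nat power_mult)
    moreover have "nat ((int a)\<^sup>2 * int (Suc n)) = a\<^sup>2 * Suc n" for n
      by (metis nat_int of_nat_mult of_nat_power)
    ultimately show ?thesis
      using partition_fps_compose_eq_suminf[OF \<open>a\<^sup>2 > 0\<close>, of "zeta N ^ (a * b)"]
      by (simp only: monomial_at_def split)
  qed
  have "(\<Prod>M \<in> cyclic_matrices N. ?h (M $ 1 $ 1) (M $ 1 $ 2))
      = (\<Prod>p\<in>primitive_pairs N. ?h (int (fst p)) (int (snd p)))"
    by (subst prod.reindex_bij_betw[OF bij, symmetric]) (simp add: case_prod_unfold)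
  also have "\<dots> = (\<Prod>p\<in>primitive_pairs N. partition_fps oo monomial_at N p)"
  proof (rule prod.cong[OF refl])
    fix p assume "p \<in> primitive_pairs N"
    with h[of "fst p" "snd p"]
    show "?h (int (fst p)) (int (snd p)) = partition_fps oo monomial_at N p"
      by (simp only: prod.collapse)
  qed
  also have "\<dots> = (partition_fps oo fps_X ^ N) ^ psi N"
    by (simp add: partition_fps_primitive_pairs[OF N] psi)
  also have "partition_fps oo fps_X ^ N =
      1 + (\<Sum>n. fps_const (of_nat (partition_number (Suc n))) * fps_X ^ (N * Suc n))"
    using partition_fps_compose_eq_suminf[OF N, of 1] by simp
  finally show "(\<Prod>M \<in> cyclic_matrices N.
        let a = M $ 1 $ 1; b = M $ 1 $ 2 in
          1 + (\<Sum>n. fps_const (zeta N powi (a * b * int (Suc n)) * of_nat (partition_number (Suc n)))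
                      * fps_X ^ nat (a\<^sup>2 * int (Suc n))))
       = (1 + (\<Sum>n. fps_const (of_nat (partition_number (Suc n))) * fps_X ^ (N * Suc n))) ^ psi N"
    by (simp only: Let_def)
qed

end
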